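(* Let $\mathcal{X}\subseteq\mathbb{R}^n\times\mathbb{R}^{m\times n}\times\mathbb{R}^m$ be a domain of LP problems. If the optimal value function $V$ is continuous on $\mathcal{X}$, then the solution correspondence $S:\mathcal{X}\to\to\mathbb{R}^n_+$ is upper semicontinuous on $\mathcal{X}$.
   Context: Let $m,n$ be positive integers. An $m\times n$ LP problem is a triple $\xi=(p,A,b)\in\mathbb{R}^n\times\mathbb{R}^{m\times n}\times\mathbb{R}^m$, standing for: maximize $p^Tx$ subject to $Ax=b$, $x\ge 0$ (coordinatewise). Its feasible set is $X(\xi)=\{x\in\mathbb{R}^n_+ : Ax=b\}$ and its set of optimal solutions is $S(\xi)=\{x\in X(\xi): p^Tx\ge p^Tx' \text{ for all } x'\in X(\xi)\}$. A domain is a non-empty subset $\mathcal{X}$ of $\mathbb{R}^n\times\mathbb{R}^{m\times n}\times\mathbb{R}^m$ such that $S(\xi)\neq\emptyset$ for every $\xi\in\mathcal{X}$. The optimal value function $V:\mathcal{X}\to\mathbb{R}$ is $V(p,A,b)=p^Tx$ for any $x\in S(p,A,b)$. The solution correspondence on $\mathcal{X}$ is the set-valued map $\xi\mapsto S(\xi)$ from $\mathcal{X}$ to subsets of $\mathbb{R}^n_+$. Convergence of LP problems means convergence of each component $p$, $A$, $b$ in Euclidean norm; continuity of $V$ is with respect to this convergence within $\mathcal{X}$. A correspondence (set-valued map) $F:\mathcal{X}\to\to Y$, $Y$ a subset of a Euclidean space, is upper semicontinuous at $\xi\in\mathcal{X}$ if for all sequences $\xi(N)\to\xi$ in $\mathcal{X}$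 and $y(N)\to y$ in $Y$ with limit $y\in Y$, $y(N)\in F(\xi(N))$ for all $N\in\mathbb{N}$ implies $y\in F(\xi)$; it is upper semicontinuous on $\mathcal{X}$ if it is so at every $\xi\in\mathcal{X}$. *)

theory Defs
  imports "HOL-Analysis.Analysis"
begin

(* An LP problem (p, A, b): maximize p \<bullet> x subject to A *v x = b, x \<ge> 0.
   A has rows indexed by 'm and columns indexed by 'n. *)
type_synonym ('m, 'n) lp = "(real ^ 'n) \<times> (real ^ 'n ^ 'm) \<times> (real ^ 'm)"

definition nonneg_orthant :: "(real ^ 'n) set" where
  "nonneg_orthant = {x. \<forall>i. 0 \<le> x $ i}"

definition lp_feasible :: "('m::finite, 'n::finite) lp \<Rightarrow> (real ^ 'n) set" where
  "lp_feasible \<xi> = (case \<xi> of (p, A, b) \<Rightarrow> {x \<in> nonneg_orthant. A *v x = b})"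

definition lp_solutions :: "('m::finite, 'n::finite) lp \<Rightarrow> (real ^ 'n) set" where
  "lp_solutions \<xi> = (case \<xi> of (p, A, b) \<Rightarrow>
     {x \<in> lp_feasible (p, A, b). \<forall>x' \<in> lp_feasible (p, A, b). p \<bullet> x' \<le> p \<bullet> x})"

definition lp_domain :: "('m::finite, 'n::finite) lp set \<Rightarrow> bool" where
  "lp_domain X \<longleftrightarrow> X \<noteq> {} \<and> (\<forall>\<xi>\<in>X. lp_solutions \<xi> \<noteq> {})"

(* Meaningful only when lp_solutions \<xi> is non-empty; see lp_value_eq. *)
definition lp_value :: "('m::finite, 'n::finite) lp \<Rightarrow> real" where
  "lp_value \<xi> = (case \<xi> of (p, A, b) \<Rightarrow> p \<bullet> (SOME x. x \<in> lp_solutions (p, A, b)))"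

definition usc_at ::
    "'a::topological_space set \<Rightarrow> 'b::topological_space set \<Rightarrow> ('a \<Rightarrow> 'b set) \<Rightarrow> 'a \<Rightarrow> bool" where
  "usc_at X Y F \<xi> \<longleftrightarrow>
     (\<forall>\<xi>s ys y. (\<forall>N::nat. \<xi>s N \<in> X) \<longrightarrow> \<xi>s \<longlonglongrightarrow> \<xi> \<longrightarrow>
        (\<forall>N. ys N \<in> Y) \<longrightarrow> y \<in> Y \<longrightarrow> ys \<longlonglongrightarrow> y \<longrightarrow>
        (\<forall>N. ys N \<in> F (\<xi>s N)) \<longrightarrow> y \<in> F \<xi>)"

definition usc_on ::
    "'a::topological_space set \<Rightarrow> 'b::topological_space set \<Rightarrow> ('a \<Rightarrow> 'b set) \<Rightarrow> bool" where
  "usc_on X Y F \<longleftrightarrow> (\<forall>\<xi>\<in>X. usc_at X Y F \<xi>)"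

lemma lp_solutions_subset: "lp_solutions \<xi> \<subseteq> nonneg_orthant"
  by (auto simp: lp_solutions_def lp_feasible_def)

lemma lp_value_eq:
  assumes "x \<in> lp_solutions (p, A, b)"
  shows "lp_value (p, A, b) = p \<bullet> x"
proof -
  have "(SOME x. x \<in> lp_solutions (p, A, b)) \<in> lp_solutions (p, A, b)"
    using assms by (rule someI)
  with assms show ?thesis
    by (auto simp: lp_value_def lp_solutions_def intro: antisym)
qed

end

(* The graph of the feasible-set correspondence is closed, so the limit y is feasible for the
   limit problem. Its objective value is the limit of the optimal values V(\<xi>s N), which by
   continuity is V(\<xi>); a feasible point attaining the optimal value is optimal. *)
theory Submission
  imports Defs
begin

text \<open>Each component is the inner product of a row of \<open>A k\<close> with
  \<open>x k\<close>, which is jointly continuous.\<close>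

lemma tendsto_matrix_vector_mult [tendsto_intros]:
  fixes A :: "'a \<Rightarrow> real ^ 'n ^ 'm"
  assumes "(A \<longlongrightarrow> A0) F" "(x \<longlongrightarrow> x0) F"
  shows "((\<lambda>k. A k *v x k) \<longlongrightarrow> A0 *v x0) F"
  by (rule vec_tendstoI) (auto simp: matrix_vector_mul_component intro!: tendsto_intros assms)

text \<open>Both sides of \<open>A *v x = b\<close> depend continuously on the problem and the point
  together, so the equation survives the limit.\<close>

lemma lp_feasible_closed_graph:
  fixes \<xi> :: "('m::finite, 'n::finite) lp"
  assumes lim: "\<xi>s \<longlonglongrightarrow> \<xi>" "ys \<longlonglongrightarrow> y"
    and feas: "\<And>N. ys N \<in> lp_feasible (\<xi>s N)" and y: "y \<in> nonneg_orthant"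
  shows "y \<in> lp_feasible \<xi>"
proof -
  have "(\<lambda>N. fst (snd (\<xi>s N)) *v ys N) \<longlonglongrightarrow> fst (snd \<xi>) *v y"
    by (intro tendsto_intros lim)
  moreover have "fst (snd (\<xi>s N)) *v ys N = snd (snd (\<xi>s N))" for N
    using feas[of N] by (auto simp: lp_feasible_def split: prod.splits)
  moreover have "(\<lambda>N. snd (snd (\<xi>s N))) \<longlonglongrightarrow> snd (snd \<xi>)"
    by (intro tendsto_intros lim)
  ultimately have "fst (snd \<xi>) *v y = snd (snd \<xi>)"
    using LIMSEQ_unique by auto
  with y show ?thesis
    by (auto simp: lp_feasible_def split: prod.splits)
qed

text \<open>Replaces the comparison with all feasible points, whose range varies with the problem,
  by one equation that can pass to the limit. A solution must exist for the \<open>SOME\<close> in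
  \<open>lp_value\<close> to pick an optimum.\<close>

lemma lp_solutions_iff_value:
  assumes "lp_solutions \<xi> \<noteq> {}"
  shows "y \<in> lp_solutions \<xi> \<longleftrightarrow> y \<in> lp_feasible \<xi> \<and> fst \<xi> \<bullet> y = lp_value \<xi>"
proof -
  obtain p A b where \<xi>: "\<xi> = (p, A, b)" by (cases \<xi>)
  obtain x where x: "x \<in> lp_solutions (p, A, b)"
    using assms \<xi> by blast
  have "lp_value (p, A, b) = p \<bullet> x"
    using x by (rule lp_value_eq)
  \<comment> \<open>Two optima dominate each other, hence have equal value; a feasible point as good
    as the optimum \<open>x\<close> dominates whatever \<open>x\<close> does.\<close>
  with x show ?thesis
    by (auto simp: \<xi> lp_solutions_def intro: antisym)
qed

theorem proposition4:
  fixes X :: "('m::finite, 'n::finite) lp set"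
  assumes "lp_domain X"
    and "continuous_on X lp_value"
  shows "usc_on X nonneg_orthant lp_solutions"
  unfolding usc_on_def usc_at_def
proof (intro ballI allI impI)
  fix \<xi> :: "('m, 'n) lp" and \<xi>s ys y
  assume \<xi>: "\<xi> \<in> X" and \<xi>s: "\<forall>N::nat. \<xi>s N \<in> X" "\<xi>s \<longlonglongrightarrow> \<xi>"
    and y: "y \<in> nonneg_orthant" "ys \<longlonglongrightarrow> y" and sol: "\<forall>N. ys N \<in> lp_solutions (\<xi>s N)"
  have nonempty: "lp_solutions \<zeta> \<noteq> {}" if "\<zeta> \<in> X" for \<zeta>
    using assms(1) that by (auto simp: lp_domain_def)
  have ys: "ys N \<in> lp_feasible (\<xi>s N)" "fst (\<xi>s N) \<bullet> ys N = lp_value (\<xi>s N)" for N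
    using sol lp_solutions_iff_value[OF nonempty] \<xi>s(1) by blast+
  have "(\<lambda>N. lp_value (\<xi>s N)) \<longlonglongrightarrow> lp_value \<xi>"
    using continuous_on_tendsto_compose[OF assms(2) \<xi>s(2) \<xi>] \<xi>s(1) by simp
  moreover have "(\<lambda>N. fst (\<xi>s N) \<bullet> ys N) \<longlonglongrightarrow> fst \<xi> \<bullet> y"
    by (intro tendsto_intros \<xi>s(2) y(2))
  \<comment> \<open>By \<open>ys(2)\<close> both limits belong to the same real sequence.\<close>
  ultimately have "fst \<xi> \<bullet> y = lp_value \<xi>"
    using LIMSEQ_unique by (auto simp: ys(2))
  moreover have "y \<in> lp_feasible \<xi>"
    using \<xi>s(2) y(2) ys(1) y(1) by (rule lp_feasible_closed_graph)
  ultimately show "y \<in> lp_solutions \<xi>"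
    using lp_solutions_iff_value[OF nonempty[OF \<xi>]] by blast
qed

end
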